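(* Let $(X,\delta_{\Phi_1})$ and $(Y,\delta_{\Phi_2})$ be descriptive proximity spaces with probe functions $\Phi_1:X\to\mathbb{R}^n$ and $\Phi_2:Y\to\mathbb{R}^n$, let $f:(X,\delta_{\Phi_1})\to(X,\delta_{\Phi_1})$ and $g:(Y,\delta_{\Phi_2})\to(Y,\delta_{\Phi_2})$ be descriptive proximally continuous maps, and let $h:(X,\delta_{\Phi_1})\to(Y,\delta_{\Phi_2})$ be a proximal descriptive conjugacy between $f$ and $g$. Let $A\in 2^X$. (a) If $A$ is a descriptively fixed subset of $f$, then $h(A)$ is a descriptively fixed subset of $g$. (b) If $A$ is an eventual descriptively fixed subset of $f$, then $h(A)$ is an eventual descriptively fixed subset of $g$. (c) If $A$ is an almost descriptively fixed subset of $f$, then $h(A)$ is an almost descriptively fixed subset of $g$.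
   Context: $2^X$ is the collection of subsets of $X$. A probe function $\Phi:X\to\mathbb{R}^n$ assigns to each point a feature vector; for $A\subseteq X$, $\Phi(A)=\{\Phi(x):x\in A\}$. The descriptive intersection of $A,B\in 2^X$ is $A\cap_\Phi B=\{x\in A\cup B:\Phi(x)\in\Phi(A)\cap\Phi(B)\}$. The descriptive proximity relation $\delta_\Phi$ on $2^X$ satisfies: $A\ \delta_\Phi\ B$ holds if and only if $A\cap_\Phi B\neq\emptyset$, i.e. iff there are $x\in A$, $y\in B$ with $\Phi(x)=\Phi(y)$; the pair $(X,\delta_\Phi)$ is a descriptive (Čech) proximity space. A map $f:(X,\delta_{\Phi_1})\to(Y,\delta_{\Phi_2})$ is descriptive proximally continuous if $A\ \delta_{\Phi_1}\ B$ implies $f(A)\ \delta_{\Phi_2}\ f(B)$ for all $A,B\in 2^X$. It is a proximal descriptive isomorphism if it is bijective and both it and its inverse are descriptive proximally continuous. A proximal descriptive conjugacy between $f:(X,\delta_{\Phi_1})\to(X,\delta_{\Phi_1})$ and $g:(Y,\delta_{\Phi_2})\to(Y,\delta_{\Phi_2})$ is a proximal descriptive isomorphism $h:(X,\delta_{\Phi_1})\to(Y,\delta_{\Phi_2})$ such that $\Phi_2(g(h(A)))=\Phi_2(h(f(A)))$ for every $A\in 2^X$. For a descriptive proximally continuous map $f:(X,\delta_\Phi)\to(X,\delta_\Phi)$ and $A\in 2^X$: - $A$ is a descriptively fixed subset of $f$ if $\Phi(f(A))=\Phi(A)$. - $A$ is an eventual descriptively fixed subset of $f$ if $A$ is not a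 descriptively fixed subset of $f$ but $f^t(A)$ is a descriptively fixed subset of $f$ for some positive integer $t\neq 1$. - $A$ is an almost descriptively fixed subset of $f$ if $\Phi(f(A))=\Phi(A)$ or $f(A)\ \delta_\Phi\ A$ (so that $f(A)\cap_\Phi A\neq\emptyset$). *)

theory Defs
  imports "HOL-Analysis.Finite_Cartesian_Product" "HOL-Library.FuncSet"
begin

text \<open>
  Spaces are given by a carrier set \<open>X\<close> and a probe function \<open>\<Phi>\<close>, of which only the
  values on \<open>X\<close> matter; likewise a self-map of \<open>X\<close> is a function of which only the values
  on \<open>X\<close> matter.
\<close>

definition descriptive_inter :: "('a \<Rightarrow> real ^ 'n) \<Rightarrow> 'a set \<Rightarrow> 'a set \<Rightarrow> 'a set" where
  "descriptive_inter \<Phi> A B = {x \<in> A \<union> B. \<Phi> x \<in> \<Phi> ` A \<inter> \<Phi> ` B}"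

definition descriptive_near :: "('a \<Rightarrow> real ^ 'n) \<Rightarrow> 'a set \<Rightarrow> 'a set \<Rightarrow> bool" where
  "descriptive_near \<Phi> A B \<longleftrightarrow> descriptive_inter \<Phi> A B \<noteq> {}"

definition desc_prox_continuous ::
  "'a set \<Rightarrow> ('a \<Rightarrow> real ^ 'n) \<Rightarrow> 'b set \<Rightarrow> ('b \<Rightarrow> real ^ 'm) \<Rightarrow> ('a \<Rightarrow> 'b) \<Rightarrow> bool" where
  "desc_prox_continuous X \<Phi>1 Y \<Phi>2 f \<longleftrightarrow>
     f \<in> X \<rightarrow> Y \<and>
     (\<forall>A B. A \<subseteq> X \<longrightarrow> B \<subseteq> X \<longrightarrow> descriptive_near \<Phi>1 A B \<longrightarrow> descriptive_near \<Phi>2 (f ` A) (f ` B))"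

definition prox_desc_isomorphism ::
  "'a set \<Rightarrow> ('a \<Rightarrow> real ^ 'n) \<Rightarrow> 'b set \<Rightarrow> ('b \<Rightarrow> real ^ 'm) \<Rightarrow> ('a \<Rightarrow> 'b) \<Rightarrow> bool" where
  "prox_desc_isomorphism X \<Phi>1 Y \<Phi>2 h \<longleftrightarrow>
     bij_betw h X Y \<and>
     desc_prox_continuous X \<Phi>1 Y \<Phi>2 h \<and>
     desc_prox_continuous Y \<Phi>2 X \<Phi>1 (inv_into X h)"

definition prox_desc_conjugacy ::
  "'a set \<Rightarrow> ('a \<Rightarrow> real ^ 'n) \<Rightarrow> ('a \<Rightarrow> 'a) \<Rightarrow>
   'b set \<Rightarrow> ('b \<Rightarrow> real ^ 'm) \<Rightarrow> ('b \<Rightarrow> 'b) \<Rightarrow> ('a \<Rightarrow> 'b) \<Rightarrow> bool" where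
  "prox_desc_conjugacy X \<Phi>1 f Y \<Phi>2 g h \<longleftrightarrow>
     prox_desc_isomorphism X \<Phi>1 Y \<Phi>2 h \<and>
     (\<forall>A. A \<subseteq> X \<longrightarrow> \<Phi>2 ` g ` h ` A = \<Phi>2 ` h ` f ` A)"

definition descriptively_fixed ::
  "'a set \<Rightarrow> ('a \<Rightarrow> real ^ 'n) \<Rightarrow> ('a \<Rightarrow> 'a) \<Rightarrow> 'a set \<Rightarrow> bool" where
  "descriptively_fixed X \<Phi> f A \<longleftrightarrow> A \<subseteq> X \<and> \<Phi> ` f ` A = \<Phi> ` A"

definition eventual_descriptively_fixed ::
  "'a set \<Rightarrow> ('a \<Rightarrow> real ^ 'n) \<Rightarrow> ('a \<Rightarrow> 'a) \<Rightarrow> 'a set \<Rightarrow> bool" where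
  "eventual_descriptively_fixed X \<Phi> f A \<longleftrightarrow>
     A \<subseteq> X \<and> \<not> descriptively_fixed X \<Phi> f A \<and>
     (\<exists>t::nat. t > 0 \<and> t \<noteq> 1 \<and> descriptively_fixed X \<Phi> f ((f ^^ t) ` A))"

definition almost_descriptively_fixed ::
  "'a set \<Rightarrow> ('a \<Rightarrow> real ^ 'n) \<Rightarrow> ('a \<Rightarrow> 'a) \<Rightarrow> 'a set \<Rightarrow> bool" where
  "almost_descriptively_fixed X \<Phi> f A \<longleftrightarrow>
     A \<subseteq> X \<and> (\<Phi> ` f ` A = \<Phi> ` A \<or> descriptive_near \<Phi> (f ` A) A)"

end

theory Submission imports Defs begin

text \<open>
  Tested on singletons, descriptive proximal continuity says exactly that a map sends points
  with equal descriptions to points with equal descriptions. Hence whether a set is descriptively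
  fixed depends only on its image under the probe function, a proximal descriptive isomorphism
  preserves and reflects equality of these images, and
  \<open>\<Phi>2 (g\<^sup>t (h x)) = \<Phi>2 (h (f\<^sup>t x))\<close> follows by induction on \<open>t\<close>. The reflecting direction is what
  makes \<open>h ` A\<close> not descriptively fixed when \<open>A\<close> is not.
\<close>

text \<open>A point of the descriptive intersection need only lie in one of the two sets, but its
  description is attained in both. Nearness thus amounts to the two sets of descriptions
  overlapping.\<close>

lemma descriptive_near_iff:
  "descriptive_near \<Phi> A B \<longleftrightarrow> (\<exists>x\<in>A. \<exists>y\<in>B. \<Phi> x = \<Phi> y)"
proof
  assume "descriptive_near \<Phi> A B"
  then obtain z where "\<Phi> z \<in> \<Phi> ` A" "\<Phi> z \<in> \<Phi> ` B"
    unfolding descriptive_near_def descriptive_inter_def by auto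
  then show "\<exists>x\<in>A. \<exists>y\<in>B. \<Phi> x = \<Phi> y"
    by (metis imageE)
next
  assume "\<exists>x\<in>A. \<exists>y\<in>B. \<Phi> x = \<Phi> y"
  then obtain x y where "x \<in> A" "y \<in> B" "\<Phi> x = \<Phi> y"
    by blast
  then have "\<Phi> x \<in> \<Phi> ` A" "\<Phi> x \<in> \<Phi> ` B"
    by (blast, metis imageI)
  then have "x \<in> descriptive_inter \<Phi> A B"
    using \<open>x \<in> A\<close> by (simp add: descriptive_inter_def)
  then show "descriptive_near \<Phi> A B"
    unfolding descriptive_near_def by blast
qed

lemma desc_prox_continuous_near:
  assumes "desc_prox_continuous X \<Phi>1 Y \<Phi>2 f" "A \<subseteq> X" "B \<subseteq> X" "descriptive_near \<Phi>1 A B"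
  shows "descriptive_near \<Phi>2 (f ` A) (f ` B)"
  using assms(1)[unfolded desc_prox_continuous_def, THEN conjunct2, rule_format, OF assms(2-4)] .

lemma desc_prox_continuous_cong:
  assumes "desc_prox_continuous X \<Phi>1 Y \<Phi>2 f" "x \<in> X" "y \<in> X" "\<Phi>1 x = \<Phi>1 y"
  shows "\<Phi>2 (f x) = \<Phi>2 (f y)"
proof -
  have "descriptive_near \<Phi>1 {x} {y}"
    using assms(4) by (simp add: descriptive_near_iff)
  then have "descriptive_near \<Phi>2 (f ` {x}) (f ` {y})"
    using desc_prox_continuous_near[OF assms(1)] assms(2,3) by blast
  then show ?thesis
    by (simp add: descriptive_near_iff)
qed

lemma desc_prox_continuous_image_subset:
  assumes "desc_prox_continuous X \<Phi>1 Y \<Phi>2 f" "A \<subseteq> X"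
  shows "f ` A \<subseteq> Y"
  using assms(1)[unfolded desc_prox_continuous_def, THEN conjunct1] assms(2) by blast

lemma desc_prox_continuous_funpow_image_subset:
  assumes "desc_prox_continuous X \<Phi>1 X \<Phi>1 f" "A \<subseteq> X"
  shows "(f ^^ t) ` A \<subseteq> X"
proof (induction t)
  case (Suc t)
  have "(f ^^ Suc t) ` A = f ` (f ^^ t) ` A"
    by (simp add: image_comp)
  then show ?case
    using desc_prox_continuous_image_subset[OF assms(1) Suc.IH] by simp
qed (simp add: assms(2))

text \<open>Each point of \<open>A\<close> has a partner in \<open>B\<close> with the same
  description, and \<open>f\<close> keeps the descriptions of the two equal.\<close>

lemma desc_prox_continuous_image_mono:
  assumes "desc_prox_continuous X \<Phi>1 Y \<Phi>2 f" "A \<subseteq> X" "B \<subseteq> X" "\<Phi>1 ` A \<subseteq> \<Phi>1 ` B"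
  shows "\<Phi>2 ` f ` A \<subseteq> \<Phi>2 ` f ` B"
proof -
  have "\<Phi>2 (f x) \<in> \<Phi>2 ` f ` B" if "x \<in> A" for x
  proof -
    obtain y where y: "y \<in> B" "\<Phi>1 x = \<Phi>1 y"
      using assms(4) \<open>x \<in> A\<close> by blast
    have "\<Phi>2 (f x) = \<Phi>2 (f y)"
      using desc_prox_continuous_cong[OF assms(1) _ _ y(2)] assms(2,3) \<open>x \<in> A\<close> y(1) by blast
    then show ?thesis
      using y(1) by simp
  qed
  then show ?thesis
    by blast
qed

lemma desc_prox_continuous_image_eq:
  assumes "desc_prox_continuous X \<Phi>1 Y \<Phi>2 f" "A \<subseteq> X" "B \<subseteq> X" "\<Phi>1 ` A = \<Phi>1 ` B"
  shows "\<Phi>2 ` f ` A = \<Phi>2 ` f ` B"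
  by (intro equalityI desc_prox_continuous_image_mono[OF assms(1)] assms(2,3))
    (simp_all only: assms(4) order_refl)

text \<open>Both sides of the fixedness equation depend on the set only through its descriptions.
  This matters because a conjugacy identifies sets only up to description.\<close>

lemma descriptively_fixed_cong:
  assumes "desc_prox_continuous X \<Phi> X \<Phi> f" "A \<subseteq> X" "B \<subseteq> X" "\<Phi> ` A = \<Phi> ` B"
  shows "descriptively_fixed X \<Phi> f A \<longleftrightarrow> descriptively_fixed X \<Phi> f B"
  using desc_prox_continuous_image_eq[OF assms] assms(2-4)
  by (simp add: descriptively_fixed_def)

lemma prox_desc_isomorphism_image_eq_iff:
  assumes "prox_desc_isomorphism X \<Phi>1 Y \<Phi>2 h" "A \<subseteq> X" "B \<subseteq> X"
  shows "\<Phi>2 ` h ` A = \<Phi>2 ` h ` B \<longleftrightarrow> \<Phi>1 ` A = \<Phi>1 ` B"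
proof
  have bij: "bij_betw h X Y" and inv: "desc_prox_continuous Y \<Phi>2 X \<Phi>1 (inv_into X h)"
    using assms(1) by (simp_all add: prox_desc_isomorphism_def)
  have hY: "h ` A \<subseteq> Y" "h ` B \<subseteq> Y"
    using assms(2,3) bij_betw_imp_surj_on[OF bij] by auto
  \<comment> \<open>Reflection comes from the continuity of the inverse, which cancels against
    \<open>h\<close> by injectivity on \<open>X\<close>.\<close>
  assume "\<Phi>2 ` h ` A = \<Phi>2 ` h ` B"
  then have "\<Phi>1 ` inv_into X h ` h ` A = \<Phi>1 ` inv_into X h ` h ` B"
    by (rule desc_prox_continuous_image_eq[OF inv hY])
  then show "\<Phi>1 ` A = \<Phi>1 ` B"
    using assms(2,3) bij_betw_imp_inj_on[OF bij] by simp
next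
  have cont: "desc_prox_continuous X \<Phi>1 Y \<Phi>2 h"
    using assms(1) by (simp add: prox_desc_isomorphism_def)
  assume "\<Phi>1 ` A = \<Phi>1 ` B"
  then show "\<Phi>2 ` h ` A = \<Phi>2 ` h ` B"
    by (rule desc_prox_continuous_image_eq[OF cont assms(2,3)])
qed

lemma prox_desc_conjugacy_funpow:
  assumes "desc_prox_continuous X \<Phi>1 X \<Phi>1 f" "desc_prox_continuous Y \<Phi>2 Y \<Phi>2 g"
    and "prox_desc_conjugacy X \<Phi>1 f Y \<Phi>2 g h" "A \<subseteq> X"
  shows "\<Phi>2 ` (g ^^ t) ` h ` A = \<Phi>2 ` h ` (f ^^ t) ` A"
proof (induction t)
  case (Suc t)
  have fX: "(f ^^ t) ` A \<subseteq> X"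
    by (rule desc_prox_continuous_funpow_image_subset[OF assms(1,4)])
  have "desc_prox_continuous X \<Phi>1 Y \<Phi>2 h"
    using assms(3) by (simp add: prox_desc_conjugacy_def prox_desc_isomorphism_def)
  note hY = desc_prox_continuous_image_subset[OF this]
  have "\<Phi>2 ` (g ^^ Suc t) ` h ` A = \<Phi>2 ` g ` (g ^^ t) ` h ` A"
    by (simp add: image_comp)
  \<comment> \<open>The induction hypothesis equates descriptions, not sets; continuity of
    \<open>g\<close> carries it through one more application of \<open>g\<close>.\<close>
  also have "\<dots> = \<Phi>2 ` g ` h ` (f ^^ t) ` A"
    by (rule desc_prox_continuous_image_eq[OF assms(2) _ hY[OF fX] Suc.IH])
      (rule desc_prox_continuous_funpow_image_subset[OF assms(2) hY[OF assms(4)]])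
  \<comment> \<open>Here the conjugacy equation is taken at the iterated image of \<open>A\<close>,
    a subset of \<open>X\<close> by \<open>fX\<close>.\<close>
  also have "\<dots> = \<Phi>2 ` h ` f ` (f ^^ t) ` A"
    using assms(3) fX by (simp add: prox_desc_conjugacy_def)
  also have "\<dots> = \<Phi>2 ` h ` (f ^^ Suc t) ` A"
    by (simp add: image_comp)
  finally show ?case .
qed simp

text \<open>By conjugacy, fixedness of h(A) under \<open>g\<close> says that h(f(A)) and h(A) have
  the same descriptions, which by the isomorphism means that f(A) and A do.\<close>

lemma prox_desc_conjugacy_fixed_iff:
  assumes "desc_prox_continuous X \<Phi>1 X \<Phi>1 f" "prox_desc_conjugacy X \<Phi>1 f Y \<Phi>2 g h" "A \<subseteq> X"
  shows "descriptively_fixed Y \<Phi>2 g (h ` A) \<longleftrightarrow> descriptively_fixed X \<Phi>1 f A"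
proof -
  have iso: "prox_desc_isomorphism X \<Phi>1 Y \<Phi>2 h" and "\<Phi>2 ` g ` h ` A = \<Phi>2 ` h ` f ` A"
    using assms(2,3) by (simp_all add: prox_desc_conjugacy_def)
  moreover have "desc_prox_continuous X \<Phi>1 Y \<Phi>2 h"
    using iso by (simp add: prox_desc_isomorphism_def)
  then have "h ` A \<subseteq> Y"
    by (rule desc_prox_continuous_image_subset[OF _ assms(3)])
  moreover have "f ` A \<subseteq> X"
    by (rule desc_prox_continuous_image_subset[OF assms(1,3)])
  ultimately show ?thesis
    using prox_desc_isomorphism_image_eq_iff[OF iso _ assms(3)] assms(3)
    by (simp add: descriptively_fixed_def)
qed

theorem corollary1:
  fixes X :: "'a set" and Y :: "'b set"
    and \<Phi>1 :: "'a \<Rightarrow> real ^ 'n" and \<Phi>2 :: "'b \<Rightarrow> real ^ 'n"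
    and f :: "'a \<Rightarrow> 'a" and g :: "'b \<Rightarrow> 'b" and h :: "'a \<Rightarrow> 'b"
    and A :: "'a set"
  assumes "desc_prox_continuous X \<Phi>1 X \<Phi>1 f"
    and "desc_prox_continuous Y \<Phi>2 Y \<Phi>2 g"
    and "prox_desc_conjugacy X \<Phi>1 f Y \<Phi>2 g h"
    and "A \<subseteq> X"
  shows "(descriptively_fixed X \<Phi>1 f A \<longrightarrow> descriptively_fixed Y \<Phi>2 g (h ` A)) \<and>
    (eventual_descriptively_fixed X \<Phi>1 f A \<longrightarrow> eventual_descriptively_fixed Y \<Phi>2 g (h ` A)) \<and>
    (almost_descriptively_fixed X \<Phi>1 f A \<longrightarrow> almost_descriptively_fixed Y \<Phi>2 g (h ` A))"
proof (intro conjI impI)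
  have cont: "desc_prox_continuous X \<Phi>1 Y \<Phi>2 h"
    and conj: "\<Phi>2 ` g ` h ` A = \<Phi>2 ` h ` f ` A"
    using assms(3,4) by (simp_all add: prox_desc_conjugacy_def prox_desc_isomorphism_def)
  note hY = desc_prox_continuous_image_subset[OF cont]
  note fixed_iff = prox_desc_conjugacy_fixed_iff[OF assms(1,3)]
  show "descriptively_fixed Y \<Phi>2 g (h ` A)" if "descriptively_fixed X \<Phi>1 f A"
    using that fixed_iff[OF assms(4)] by simp
  show "eventual_descriptively_fixed Y \<Phi>2 g (h ` A)"
    if ev: "eventual_descriptively_fixed X \<Phi>1 f A"
  proof -
    obtain t where t: "t > 0" "t \<noteq> 1" "descriptively_fixed X \<Phi>1 f ((f ^^ t) ` A)"
      using ev by (auto simp: eventual_descriptively_fixed_def)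
    have fX: "(f ^^ t) ` A \<subseteq> X"
      by (rule desc_prox_continuous_funpow_image_subset[OF assms(1,4)])
    have "descriptively_fixed Y \<Phi>2 g (h ` (f ^^ t) ` A)"
      using t(3) fixed_iff[OF fX] by simp
    \<comment> \<open>The sets h(f^t(A)) and g^t(h(A)) may differ, but their descriptions agree, so
      fixedness passes from one to the other.\<close>
    then have "descriptively_fixed Y \<Phi>2 g ((g ^^ t) ` h ` A)"
      using descriptively_fixed_cong[OF assms(2)
          desc_prox_continuous_funpow_image_subset[OF assms(2) hY[OF assms(4)]] hY[OF fX]
          prox_desc_conjugacy_funpow[OF assms]]
      by simp
    \<comment> \<open>The same \<open>t\<close> serves for \<open>g\<close>; if h(A) were fixed, the
      equivalence \<open>fixed_iff\<close> would make \<open>A\<close> fixed.\<close>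
    then show ?thesis
      using ev t(1,2) fixed_iff[OF assms(4)] hY[OF assms(4)]
      unfolding eventual_descriptively_fixed_def by blast
  qed
  show "almost_descriptively_fixed Y \<Phi>2 g (h ` A)"
    if alm: "almost_descriptively_fixed X \<Phi>1 f A"
  proof (cases "descriptively_fixed X \<Phi>1 f A")
    case True
    then show ?thesis
      using fixed_iff[OF assms(4)]
      by (simp add: almost_descriptively_fixed_def descriptively_fixed_def)
  next
    case False
    then have "descriptive_near \<Phi>1 (f ` A) A"
      using alm by (auto simp: almost_descriptively_fixed_def descriptively_fixed_def)
    moreover have "f ` A \<subseteq> X"
      by (rule desc_prox_continuous_image_subset[OF assms(1,4)])
    ultimately have "descriptive_near \<Phi>2 (h ` f ` A) (h ` A)"
      using desc_prox_continuous_near[OF cont] assms(4) by blast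
    \<comment> \<open>Nearness is restated as an overlap of descriptions so that the conjugacy
      equation can replace h(f(A)) by g(h(A)).\<close>
    then have "\<Phi>2 ` h ` f ` A \<inter> \<Phi>2 ` h ` A \<noteq> {}"
      unfolding descriptive_near_iff by blast
    then have "\<Phi>2 ` g ` h ` A \<inter> \<Phi>2 ` h ` A \<noteq> {}"
      using conj by simp
    then have "descriptive_near \<Phi>2 (g ` h ` A) (h ` A)"
      unfolding descriptive_near_iff by blast
    then show ?thesis
      using hY[OF assms(4)] by (simp add: almost_descriptively_fixed_def)
  qed
qed

end
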